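(* Let $B=\{E_j\}$ be any countable set of (distinct) points in $(-2,2)$ with $0\notin B+B$, let $\{\theta_j\}_j\subset[0,\pi]$ be any sequence, and let $h:\mathbb{N}\to(0,\infty)$ be any function with $h(n)\to\infty$ as $n\to\infty$ (arbitrarily slowly). Then there exist potentials $V:\mathbb{N}\to\mathbb{R}$ with $|V(n)|\le\frac{h(n)}{1+n}$ such that for each $E_j\in B$ the equation $$u(n+1)+u(n-1)+V(n)u(n)=E_ju(n)\qquad(n\ge1)$$ has a nontrivial $\ell^2(\mathbb{N})$ solution with boundary condition $\frac{u(1)}{u(0)}=\tan\theta_j$.
   Context: Here $\mathbb{N}=\{1,2,\dots\}$. For a set $B\subset\mathbb{R}$, $B+B=\{x+y: x\in B,\ y\in B\}$ (with $x=y$ allowed). The boundary condition $\frac{u(1)}{u(0)}=\tan\theta_j$ means $u(1)\cos\theta_j=u(0)\sin\theta_j$. *)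

theory Defs
  imports "HOL-Analysis.Analysis" "HOL-Library.Set_Algebras"
begin

text \<open>
  The positive integers are \<open>{1..}\<close>. Potentials and bounds are functions on \<open>nat\<close> of which only the
  values at \<open>n \<ge> 1\<close> matter; a solution \<open>u\<close> additionally uses its boundary value \<open>u 0\<close>.
\<close>

definition schroedinger_solution :: "(nat \<Rightarrow> real) \<Rightarrow> real \<Rightarrow> (nat \<Rightarrow> real) \<Rightarrow> bool" where
  "schroedinger_solution V E u \<longleftrightarrow>
     (\<forall>n\<ge>1. u (n + 1) + u (n - 1) + V n * u n = E * u n)"

definition square_summable :: "(nat \<Rightarrow> real) \<Rightarrow> bool" where
  "square_summable u \<longleftrightarrow> (\<lambda>n. (u n)\<^sup>2) summable_on {1..}"

text \<open>
  The condition \<open>u 1 / u 0 = tan \<theta>\<close> in division-free form, so that \<open>\<theta> = pi / 2\<close>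
  means \<open>u 0 = 0\<close>.
\<close>

definition boundary_condition :: "real \<Rightarrow> (nat \<Rightarrow> real) \<Rightarrow> bool" where
  "boundary_condition \<theta> u \<longleftrightarrow> u 1 * cos \<theta> = u 0 * sin \<theta>"

end

theory Submission
  imports Defs
begin

text \<open>
  Write \<open>E\<^sub>j = 2 cos k\<^sub>j\<close> with \<open>0 < k\<^sub>j < \<pi>\<close>. For a solution \<open>u\<close> at this energy put
  \<open>w n = e\<^bsup>ik\<^esup> u n - u (n - 1)\<close>. For \<open>V = 0\<close> this complex number just rotates by \<open>k\<^sub>j\<close>
  at each step, and in general \<open>w (n + 1) = e\<^bsup>ik\<^esup> (w n - V n Im (w n) / sin k)\<close>. The doubled phase
  \<open>q = (w / \<bar>w\<bar>)\<^sup>2\<close> governs the growth: \<open>ln \<bar>w\<bar>\<^sup>2\<close> changes by at most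
  \<open>- V Im q / sin k + O(V\<^sup>2)\<close> (\<open>ln_norm_kick_le\<close>), while \<open>q\<close> itself turns by \<open>2 k\<close> up to an error
  \<open>O(V)\<close> (\<open>double_phase_kick\<close>).

  All solutions are damped at once by a feedback potential: fix activation times \<open>T\<^sub>i\<close> and let
  \<open>V n = 4 / (n + 1) (\<Sum>i. sin k\<^sub>i Im (q\<^sub>i n))\<close>, summed over the \<open>i\<close> with \<open>T\<^sub>i \<le> n\<close>. Since
  \<open>V n\<close> depends only on the state at time \<open>n\<close>, the potential and all solutions, started from the
  prescribed boundary values, are defined by one joint recursion.
  In the change of \<open>ln \<bar>w\<^sub>j\<bar>\<^sup>2\<close> the term \<open>i = j\<close> contributes
  \<open>- 4 (Im q\<^sub>j)\<^sup>2 / (n + 1)\<close>, whose mean is \<open>- 2 / (n + 1)\<close>. Everything else oscillates: by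
  \<open>2 Im p Im q = Re (p q\<^sup>*) - Re (p q)\<close> it is built from the products \<open>q\<^sub>i q\<^sub>j\<close> and,
  for \<open>i \<noteq> j\<close>, \<open>q\<^sub>i q\<^sub>j\<^sup>*\<close>, which rotate by the factors \<open>e\<^bsup>2i(k\<^sub>i \<plusminus> k\<^sub>j)\<^esup>\<close>. These factors differ
  from \<open>1\<close> precisely because the energies are distinct and no two of them, equal or not, add up
  to \<open>0\<close>. Summation by parts (\<open>norm_sum_rotating_le\<close>) then bounds the sum of each such term over
  all times from \<open>T\<close> on by a constant of the pair times a quantity that tends to \<open>0\<close> as
  \<open>T \<rightarrow> \<infinity>\<close> (\<open>interaction_bound_exists\<close>). Choosing \<open>T\<^sub>i\<close> large makes the interactions of
  \<open>j\<close> with all the infinitely many \<open>i\<close> summable, and at the same time keeps the number of active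
  energies at time \<open>n\<close> at most \<open>h n / 4\<close> and at most \<open>(n + 1)\<^bsup>1/4\<^esup> / 4\<close>; the latter makes
  \<open>\<Sum>n. (V n)\<^sup>2\<close> finite. Hence \<open>ln \<bar>w\<^sub>j n\<bar>\<^sup>2 \<le> C - 2 ln (n + 1)\<close> (\<open>controlled_orbit_decay\<close>), so that
  \<open>\<bar>w\<^sub>j n\<bar>\<^sup>2 = O(n\<^bsup>-2\<^esup>)\<close> is summable. The times \<open>T\<^sub>i\<close> depend only on the energies and on \<open>h\<close>,
  since the bounds on the interactions hold for every sufficiently small potential.
\<close>

section \<open>Sums against rotating sequences\<close>

text \<open>
  Summation by parts: a telescoping sum with decreasing weights is controlled by its first weight.
\<close>

lemma norm_sum_decreasing_times_differences_le:
  fixes p :: "nat \<Rightarrow> complex" and a :: "nat \<Rightarrow> real"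
  assumes p: "\<And>n. norm (p n) \<le> 1" and a: "decseq a" "\<And>n. a n \<ge> 0" and "T \<le> M"
  shows "norm (\<Sum>n=T..<M. of_real (a n) * (p (Suc n) - p n)) \<le> 2 * a T"
proof -
  define A where "A M = (\<Sum>n=T..<M. of_real (a n) * (p (Suc n) - p n))" for M
  have scaled: "norm (of_real c * p n) \<le> c" if "c \<ge> 0" for c n
    using mult_left_mono[OF p that] that by (simp add: norm_mult)
  \<comment> \<open>Removing the boundary term lets each step of the induction cost exactly the drop of \<open>a\<close>.\<close>
  have "norm (A M - of_real (a M) * p M) \<le> 2 * a T - a M"
    using \<open>T \<le> M\<close>
  proof (induction M rule: dec_induct)
    case base
    show ?case using scaled[OF a(2), of T T] by (simp add: A_def)
  next
    case (step n)
    have "A (Suc n) - of_real (a (Suc n)) * p (Suc n)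
        = (A n - of_real (a n) * p n) + of_real (a n - a (Suc n)) * p (Suc n)"
      using step.hyps by (simp add: A_def algebra_simps)
    also have "norm \<dots> \<le> (2 * a T - a n) + (a n - a (Suc n))"
      using decseq_SucD[OF a(1), of n] by (intro norm_triangle_mono step.IH scaled) simp
    finally show ?case by simp
  qed
  moreover have "A M = (A M - of_real (a M) * p M) + of_real (a M) * p M" by simp
  ultimately have "norm (A M) \<le> (2 * a T - a M) + a M"
    using scaled[OF a(2), of M M] norm_triangle_mono by metis
  then show ?thesis by (simp add: A_def)
qed

text \<open>
  If \<open>p (n + 1) \<approx> c p n\<close> with \<open>c \<noteq> 1\<close>, then \<open>(c - 1) p n\<close> is a difference \<open>p (n + 1) - p n\<close> up to
  a small error, so the weighted sum of \<open>p\<close> almost telescopes.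
\<close>

lemma norm_sum_rotating_le:
  fixes p :: "nat \<Rightarrow> complex" and a b :: "nat \<Rightarrow> real"
  assumes p: "\<And>n. norm (p n) \<le> 1" and a: "decseq a" "\<And>n. a n \<ge> 0" and "T \<le> M"
    and rot: "\<And>n. norm (p (Suc n) - c * p n) \<le> b n" and "c \<noteq> 1"
  shows "norm (\<Sum>n=T..<M. of_real (a n) * p n) \<le> (2 * a T + (\<Sum>n=T..<M. a n * b n)) / norm (c - 1)"
proof -
  have "(c - 1) * (\<Sum>n=T..<M. of_real (a n) * p n)
      = (\<Sum>n=T..<M. of_real (a n) * (p (Suc n) - p n))
        - (\<Sum>n=T..<M. of_real (a n) * (p (Suc n) - c * p n))"
    by (simp add: sum_distrib_left sum_subtractf[symmetric] algebra_simps)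
  also have "norm \<dots> \<le> 2 * a T + (\<Sum>n=T..<M. a n * b n)"
  proof (rule order_trans[OF norm_triangle_ineq4 add_mono])
    show "norm (\<Sum>n=T..<M. of_real (a n) * (p (Suc n) - c * p n)) \<le> (\<Sum>n=T..<M. a n * b n)"
      using a(2) rot by (intro sum_norm_le) (simp add: norm_mult mult_left_mono)
  qed (rule norm_sum_decreasing_times_differences_le[OF p a \<open>T \<le> M\<close>])
  finally show ?thesis
    using \<open>c \<noteq> 1\<close> by (simp add: norm_mult pos_le_divide_eq mult.commute)
qed

section \<open>The transfer map in a rotating coordinate\<close>

text \<open>
  One step of the equation at energy \<open>2 cos k\<close> with potential value \<open>v\<close>, acting on
  \<open>w = e\<^bsup>ik\<^esup> u n - u (n - 1)\<close>. As \<open>Im w = sin k u n\<close>, the subtracted term is \<open>v u n\<close>.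
\<close>

definition kick :: "real \<Rightarrow> real \<Rightarrow> complex \<Rightarrow> complex" where
  "kick k v w = cis k * (w - of_real (v * Im w / sin k))"

definition kicked_orbit :: "real \<Rightarrow> (nat \<Rightarrow> real) \<Rightarrow> (nat \<Rightarrow> complex) \<Rightarrow> bool" where
  "kicked_orbit k V w \<longleftrightarrow> w 0 \<noteq> 0 \<and> (\<forall>n. w (Suc n) = kick k (V n) (w n))"

text \<open>
  The square of the direction of \<open>w\<close>: replacing \<open>w\<close> by \<open>-w\<close> does not change the decay of a
  solution, and the first-order change of \<open>ln \<bar>w\<bar>\<^sup>2\<close> is linear in this quantity.
\<close>

abbreviation double_phase :: "complex \<Rightarrow> complex" where
  "double_phase w \<equiv> (sgn w)\<^sup>2"

text \<open>
  Up to a rotation, a kick is a shear along the real axis, hence injective.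
\<close>

lemma kick_nonzero:
  assumes "w \<noteq> 0"
  shows "kick k v w \<noteq> 0"
proof
  assume "kick k v w = 0"
  then have "w = of_real (v * Im w / sin k)" by (simp add: kick_def)
  moreover from this have "Im w = 0" by (metis Im_complex_of_real)
  ultimately show False using assms by simp
qed

lemma kicked_orbit_nonzero: "kicked_orbit k V w \<Longrightarrow> w n \<noteq> 0"
  by (induction n) (auto simp: kicked_orbit_def kick_nonzero)

text \<open>
  The imaginary parts of \<open>w (n + 1)\<close> and of \<open>e\<^bsup>-ik\<^esup> w n\<close> are \<open>sin k u (n + 1)\<close> and
  \<open>sin k u (n - 1)\<close>; adding them, \<open>e\<^bsup>ik\<^esup> + e\<^bsup>-ik\<^esup> = 2 cos k\<close> produces the energy.
\<close>

lemma kicked_orbit_solution: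
  assumes orbit: "kicked_orbit k V w" and "sin k \<noteq> 0"
  shows "schroedinger_solution V (2 * cos k) (\<lambda>n. Im (w n) / sin k)"
  unfolding schroedinger_solution_def
proof (intro allI impI)
  fix n :: nat assume "n \<ge> 1"
  then obtain m where n: "n = Suc m" by (cases n) auto
  have "cis (- k) * w n = w m - of_real (V m * Im (w m) / sin k)"
    using orbit by (simp add: n kicked_orbit_def kick_def mult.assoc[symmetric] cis_mult)
  then have previous: "cos k * Im (w n) - sin k * Re (w n) = Im (w m)"
    by (simp add: complex_eq_iff)
  have subsequent: "Im (w (n + 1)) = cos k * Im (w n) + sin k * Re (w n) - V n * Im (w n)"
    using orbit \<open>sin k \<noteq> 0\<close> by (simp add: kicked_orbit_def kick_def right_diff_distrib)
  show "Im (w (n + 1)) / sin k + Im (w (n - 1)) / sin k + V n * (Im (w n) / sin k)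
      = 2 * cos k * (Im (w n) / sin k)"
    unfolding subsequent using \<open>sin k \<noteq> 0\<close> by (simp add: n previous[unfolded n, symmetric] field_simps)
qed

lemma norm_double_phase_le_1: "norm (double_phase w) \<le> 1"
  by (simp add: norm_power norm_sgn)

lemma norm_sgn_diff_le:
  fixes w d :: complex
  assumes "w \<noteq> 0"
  shows "norm (sgn (w - d) - sgn w) \<le> 2 * norm d / norm w"
proof -
  define z where "z = w - d"
  have "of_real (norm x) * sgn x = x" for x :: complex
    by (cases "x = 0") (simp_all add: sgn_eq)
  then have "of_real (norm w) * (sgn z - sgn w) = of_real (norm w - norm z) * sgn z - d"
    by (simp add: z_def right_diff_distrib left_diff_distrib)
  also have "norm \<dots> \<le> \<bar>norm w - norm z\<bar> * norm (sgn z) + norm d"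
    by (rule order_trans[OF norm_triangle_ineq4]) (simp add: norm_mult del: of_real_diff)
  also have "\<dots> \<le> norm d * 1 + norm d"
    using norm_triangle_ineq3[of w z] by (intro add_mono mult_mono) (auto simp: z_def norm_sgn)
  finally show ?thesis using assms by (simp add: norm_mult z_def pos_le_divide_eq mult.commute)
qed

text \<open>
  The vector \<open>w\<close> is displaced by at most \<open>\<bar>v\<bar> / sin k\<close> times its length. Passing to directions
  doubles this relative error, and squaring doubles it again.
\<close>

lemma double_phase_kick:
  assumes "w \<noteq> 0" "sin k > 0"
  shows "norm (double_phase (kick k v w) - cis (2 * k) * double_phase w) \<le> 4 * \<bar>v\<bar> / sin k"
proof -
  define d where "d = complex_of_real (v * Im w / sin k)"
  have "norm d \<le> \<bar>v\<bar> * norm w / sin k"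
    using \<open>sin k > 0\<close> abs_Im_le_cmod[of w]
    by (simp add: d_def norm_mult norm_divide abs_mult divide_right_mono mult_left_mono)
  then have "norm (sgn (w - d) - sgn w) \<le> 2 * \<bar>v\<bar> / sin k"
    by (intro order_trans[OF norm_sgn_diff_le[OF \<open>w \<noteq> 0\<close>]]) (simp add: pos_divide_le_eq assms)
  moreover have "norm (sgn (w - d) + sgn w) \<le> 2"
    by (rule order_trans[OF norm_triangle_ineq]) (auto simp: norm_sgn)
  ultimately have "norm ((sgn (w - d) - sgn w) * (sgn (w - d) + sgn w)) \<le> (2 * \<bar>v\<bar> / sin k) * 2"
    unfolding norm_mult using \<open>sin k > 0\<close> by (intro mult_mono) auto
  moreover have "double_phase (kick k v w) - cis (2 * k) * double_phase w
      = cis (2 * k) * ((sgn (w - d) - sgn w) * (sgn (w - d) + sgn w))"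
  proof -
    have "double_phase (kick k v w) = cis (2 * k) * double_phase (w - d)"
      unfolding kick_def d_def[symmetric] sgn_mult power_mult_distrib
      by (simp add: sgn_eq[of "cis k"] power2_eq_square[of "cis k"] cis_mult)
    moreover have "x\<^sup>2 - y\<^sup>2 = (x - y) * (x + y)" for x y :: complex
      by (simp add: power2_eq_square algebra_simps)
    ultimately show ?thesis
      by (metis right_diff_distrib)
  qed
  ultimately show ?thesis by (simp add: norm_mult)
qed

text \<open>
  The ratio of the squared norms after and before the kick is
  \<open>1 - (v / sin k) Im q + (v / sin k)\<^sup>2 (Im w)\<^sup>2 / \<bar>w\<bar>\<^sup>2\<close> with \<open>q\<close> the doubled phase;
  only an upper bound is needed, so \<open>ln x \<le> x - 1\<close> suffices for potentials of any size.
\<close>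

lemma ln_norm_kick_le:
  assumes "w \<noteq> 0" "sin k > 0"
  shows "ln ((norm (kick k v w))\<^sup>2)
    \<le> ln ((norm w)\<^sup>2) - v / sin k * Im (double_phase w) + (v / sin k)\<^sup>2"
proof -
  define s where "s = v / sin k"
  define r where "r = (norm w)\<^sup>2"
  have r: "r > 0" "r = (Re w)\<^sup>2 + (Im w)\<^sup>2"
    using assms by (simp_all add: r_def cmod_power2[symmetric])
  have "(norm (kick k v w))\<^sup>2 = (Re w - s * Im w)\<^sup>2 + (Im w)\<^sup>2"
    by (simp add: kick_def norm_mult cmod_power2 s_def)
  also have "\<dots> = r - s * (2 * Re w * Im w) + s\<^sup>2 * (Im w)\<^sup>2"
    unfolding r by (simp add: power2_eq_square algebra_simps)
  finally have kick: "(norm (kick k v w))\<^sup>2 = r - s * (2 * Re w * Im w) + s\<^sup>2 * (Im w)\<^sup>2" .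
  have "Im (double_phase w) = 2 * Re w * Im w / r"
    using assms by (simp add: sgn_eq Im_power2 r_def power2_eq_square)
  then have phase: "2 * Re w * Im w = r * Im (double_phase w)"
    using r by simp
  have "ln ((norm (kick k v w))\<^sup>2) - ln r = ln ((norm (kick k v w))\<^sup>2 / r)"
    using kick_nonzero[OF \<open>w \<noteq> 0\<close>] r by (subst ln_div) auto
  also have "\<dots> \<le> (norm (kick k v w))\<^sup>2 / r - 1"
    using kick_nonzero[OF \<open>w \<noteq> 0\<close>] r by (intro ln_le_minus_one) simp
  also have "\<dots> = - s * Im (double_phase w) + s\<^sup>2 * ((Im w)\<^sup>2 / r)"
    unfolding kick phase using \<open>r > 0\<close> by (simp add: field_simps)
  also have "\<dots> \<le> - s * Im (double_phase w) + s\<^sup>2 * 1"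
    using r by (intro add_left_mono mult_left_mono) (auto simp: field_simps)
  finally show ?thesis by (simp add: s_def r_def)
qed

section \<open>Nonresonance\<close>

lemma cis_double_eq_1_iff: "cis (2 * x) = 1 \<longleftrightarrow> sin x = 0"
proof
  assume "cis (2 * x) = 1"
  then have "cos (2 * x) = 1" by (metis cis.sel(1) one_complex.sel(1))
  then show "sin x = 0" by (simp add: cos_double_sin)
next
  assume "sin x = 0"
  then show "cis (2 * x) = 1" by (simp add: complex_eq_iff cos_double_sin sin_double)
qed

lemma nonresonant_sum:
  assumes "0 < a" "a < pi" "0 < b" "b < pi" "cos a + cos b \<noteq> 0"
  shows "cis (2 * (a + b)) \<noteq> 1"
proof
  assume "cis (2 * (a + b)) = 1"
  then have "sin (a + b - pi) = 0" unfolding cis_double_eq_1_iff by (simp add: sin_diff)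
  moreover have "- pi < a + b - pi" "a + b - pi < pi" using assms by linarith+
  ultimately have "a + b - pi = 0" by (metis sin_eq_0_pi)
  then have "b = pi - a" by simp
  with assms show False by simp
qed

lemma nonresonant_diff:
  assumes "0 < a" "a < pi" "0 < b" "b < pi" "a \<noteq> b"
  shows "cis (2 * (a - b)) \<noteq> 1"
proof
  assume "cis (2 * (a - b)) = 1"
  then have "sin (a - b) = 0" unfolding cis_double_eq_1_iff .
  moreover have "- pi < a - b" "a - b < pi" using assms by linarith+
  ultimately have "a - b = 0" by (metis sin_eq_0_pi)
  with assms show False by simp
qed

section \<open>Interaction of two energies\<close>

text \<open>
  A summable sequence that dominates both \<open>(V n)\<^sup>2\<close> and \<open>\<bar>V n\<bar> / (n + 1)\<close> when
  \<open>\<bar>V n\<bar> \<le> (n + 1)\<^bsup>-3/4\<^esup>\<close>.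
\<close>

definition power_weight :: "nat \<Rightarrow> real" where
  "power_weight n = (real n + 1) powr (- 3 / 2)"

text \<open>
  The size of an oscillating sum started at time \<open>T\<close>: the first summand comes from the boundary
  terms of the summation by parts, the second from the phase errors.
\<close>

definition tail_weight :: "nat \<Rightarrow> real" where
  "tail_weight T = 1 / (real T + 1) + (\<Sum>n. power_weight (n + T))"

lemma summable_power_weight: "summable power_weight"
proof -
  have "summable (\<lambda>n. real (n + 1) powr (- 3 / 2))"
    by (subst summable_iff_shift) (simp add: summable_real_powr_iff)
  then show ?thesis by (simp add: power_weight_def[abs_def] add.commute)
qed

lemma power_weight_nonneg: "power_weight n \<ge> 0"
  by (simp add: power_weight_def)

lemma tail_weight_tendsto: "tail_weight \<longlonglongrightarrow> 0"
proof -
  have "(\<lambda>T. 1 / (real T + 1)) \<longlonglongrightarrow> 0"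
    using lim_inverse_n' LIMSEQ_Suc[OF lim_inverse_n'] by (simp add: add.commute)
  moreover have "(\<lambda>T. \<Sum>n. power_weight (n + T)) \<longlonglongrightarrow> 0"
    by (rule suminf_exist_split2[OF summable_power_weight])
  ultimately show ?thesis
    unfolding tail_weight_def[abs_def] using tendsto_add by fastforce
qed

lemma sum_power_weight_le_suminf: "(\<Sum>n=T..<M. power_weight n) \<le> (\<Sum>n. power_weight (n + T))"
proof -
  have "(\<Sum>n=T..<M. power_weight n) = (\<Sum>n<M - T. power_weight (n + T))"
    by (rule sum.reindex_bij_witness[of _ "\<lambda>n. n + T" "\<lambda>n. n - T"]) auto
  also have "\<dots> \<le> (\<Sum>n. power_weight (n + T))"
    using summable_power_weight
    by (intro sum_le_suminf) (auto simp: summable_iff_shift power_weight_nonneg)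
  finally show ?thesis .
qed

text \<open>
  A product of two almost rotating sequences is almost rotating, with factor \<open>c d\<close>.
\<close>

lemma rotating_product_sum_le:
  fixes p q :: "nat \<Rightarrow> complex"
  assumes V: "\<And>n. \<bar>V n\<bar> / (real n + 1) \<le> power_weight n"
    and p: "\<And>n. norm (p n) \<le> 1" "\<And>n. norm (p (Suc n) - c * p n) \<le> K * \<bar>V n\<bar>"
    and q: "\<And>n. norm (q n) \<le> 1" "\<And>n. norm (q (Suc n) - d * q n) \<le> L * \<bar>V n\<bar>"
    and "norm c \<le> 1" "c * d \<noteq> 1" "K \<ge> 0" "L \<ge> 0" "T \<le> M"
  shows "norm (\<Sum>n=T..<M. p n * q n / of_real (real n + 1))
    \<le> (2 + K + L) / norm (c * d - 1) * tail_weight T"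
proof -
  have "norm (p (Suc n) * q (Suc n) - c * d * (p n * q n)) \<le> (K + L) * \<bar>V n\<bar>" for n
  proof -
    have "p (Suc n) * q (Suc n) - c * d * (p n * q n)
        = (p (Suc n) - c * p n) * q (Suc n) + c * p n * (q (Suc n) - d * q n)"
      by (simp add: algebra_simps)
    also have "norm \<dots> \<le> K * \<bar>V n\<bar> * 1 + 1 * 1 * (L * \<bar>V n\<bar>)"
      by (intro norm_triangle_mono; unfold norm_mult; intro mult_mono)
        (use p q \<open>norm c \<le> 1\<close> \<open>K \<ge> 0\<close> in auto)
    finally show ?thesis by (simp add: algebra_simps)
  qed
  then have "norm (\<Sum>n=T..<M. of_real (1 / (real n + 1)) * (p n * q n))
      \<le> (2 * (1 / (real T + 1)) + (\<Sum>n=T..<M. 1 / (real n + 1) * ((K + L) * \<bar>V n\<bar>))) / norm (c * d - 1)"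
    using p q \<open>c * d \<noteq> 1\<close> \<open>T \<le> M\<close>
    by (intro norm_sum_rotating_le) (auto simp: norm_mult mult_le_one decseq_def frac_le)
  also have "\<dots> \<le> ((2 + K + L) * tail_weight T) / norm (c * d - 1)"
  proof (rule divide_right_mono)
    have "(\<Sum>n=T..<M. 1 / (real n + 1) * ((K + L) * \<bar>V n\<bar>)) = (K + L) * (\<Sum>n=T..<M. \<bar>V n\<bar> / (real n + 1))"
      by (simp add: sum_distrib_left)
    also have "\<dots> \<le> (K + L) * (\<Sum>n. power_weight (n + T))"
      using \<open>K \<ge> 0\<close> \<open>L \<ge> 0\<close> V sum_power_weight_le_suminf[of T M]
      by (intro mult_left_mono) (auto intro: order_trans[OF sum_mono])
    finally have "(\<Sum>n=T..<M. 1 / (real n + 1) * ((K + L) * \<bar>V n\<bar>))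
        \<le> (K + L) * (\<Sum>n. power_weight (n + T))" .
    moreover have "0 \<le> (K + L) * (1 / (real T + 1))" "0 \<le> (\<Sum>n. power_weight (n + T))"
      using \<open>K \<ge> 0\<close> \<open>L \<ge> 0\<close> summable_power_weight
      by (auto intro!: suminf_nonneg simp: power_weight_nonneg summable_iff_shift)
    moreover have "(2 + K + L) * tail_weight T = 2 * (1 / (real T + 1)) + (K + L) * (1 / (real T + 1))
        + 2 * (\<Sum>n. power_weight (n + T)) + (K + L) * (\<Sum>n. power_weight (n + T))"
      unfolding tail_weight_def by (simp only: distrib_left distrib_right add_ac)
    ultimately show "2 * (1 / (real T + 1)) + (\<Sum>n=T..<M. 1 / (real n + 1) * ((K + L) * \<bar>V n\<bar>))
        \<le> (2 + K + L) * tail_weight T"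
      by linarith
  qed simp
  finally show ?thesis by simp
qed

text \<open>
  The effect of the feedback for wave number \<open>a\<close> on the solution for \<open>b\<close>, with the mean value
  that occurs for \<open>a = b\<close> subtracted.
\<close>

definition interaction :: "real \<Rightarrow> real \<Rightarrow> complex \<Rightarrow> complex \<Rightarrow> real" where
  "interaction a b w z =
     2 * Im (double_phase w) * Im (double_phase z) - (if a = b then 1 else 0)"

text \<open>
  The constant has to be uniform in the potential, the orbits and the starting time, because it
  enters the choice of the activation times, on which the potential depends.
\<close>

definition interaction_bound :: "real \<Rightarrow> real \<Rightarrow> real \<Rightarrow> bool" where
  "interaction_bound a b D \<longleftrightarrow> (\<forall>V w z T M.
     (\<forall>n. \<bar>V n\<bar> / (real n + 1) \<le> power_weight n) \<longrightarrow> kicked_orbit a V w \<longrightarrow> kicked_orbit b V z \<longrightarrow>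
     (a = b \<longrightarrow> w = z) \<longrightarrow> T \<le> M \<longrightarrow>
     \<bar>\<Sum>n=T..<M. interaction a b (w n) (z n) / (real n + 1)\<bar> \<le> D * tail_weight T)"

text \<open>
  For \<open>a \<noteq> b\<close> the interaction is \<open>Re (p q\<^sup>*) - Re (p q)\<close>, whose two parts rotate with
  \<open>e\<^bsup>2i(a - b)\<^esup>\<close> and \<open>e\<^bsup>2i(a + b)\<^esup>\<close>. For \<open>a = b\<close> and equal orbits the first part is constantly
  \<open>1\<close>, which is the mean that has been subtracted.
\<close>

lemma interaction_bound_exists:
  assumes "sin a > 0" "sin b > 0" "cis (2 * (a + b)) \<noteq> 1" "a \<noteq> b \<longrightarrow> cis (2 * (a - b)) \<noteq> 1"
  shows "\<exists>D. interaction_bound a b D"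
proof -
  define K where "K = 2 + 4 / sin a + 4 / sin b"
  define C where "C x = K / norm (cis (2 * x) - 1)" for x
  have "\<bar>\<Sum>n=T..<M. interaction a b (w n) (z n) / (real n + 1)\<bar>
      \<le> ((if a = b then 0 else C (a - b)) + C (a + b)) * tail_weight T"
    if V: "\<forall>n. \<bar>V n\<bar> / (real n + 1) \<le> power_weight n"
      and w: "kicked_orbit a V w" and z: "kicked_orbit b V z" and same: "a = b \<longrightarrow> w = z"
      and "T \<le> M" for V w z T M
  proof -
    define p where "p n = double_phase (w n)" for n
    define q where "q n = double_phase (z n)" for n
    define S where "S x = (\<Sum>n=T..<M. x n / of_real (real n + 1))" for x :: "nat \<Rightarrow> complex"
    have p: "norm (p n) \<le> 1" "norm (p (Suc n) - cis (2 * a) * p n) \<le> 4 / sin a * \<bar>V n\<bar>" for n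
      using double_phase_kick[OF kicked_orbit_nonzero[OF w, of n] assms(1), where v = "V n"] w
      by (auto simp: p_def norm_double_phase_le_1 kicked_orbit_def)
    have q: "norm (q n) \<le> 1" "norm (q (Suc n) - cis (2 * b) * q n) \<le> 4 / sin b * \<bar>V n\<bar>" for n
      using double_phase_kick[OF kicked_orbit_nonzero[OF z, of n] assms(2), where v = "V n"] z
      by (auto simp: q_def norm_double_phase_le_1 kicked_orbit_def)
    have cnj_q: "norm (cnj (q n)) \<le> 1"
        "norm (cnj (q (Suc n)) - cis (- 2 * b) * cnj (q n)) \<le> 4 / sin b * \<bar>V n\<bar>" for n
    proof -
      have "cnj (q (Suc n)) - cis (- 2 * b) * cnj (q n) = cnj (q (Suc n) - cis (2 * b) * q n)"
        by (simp add: cis_cnj)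
      then show "norm (cnj (q (Suc n)) - cis (- 2 * b) * cnj (q n)) \<le> 4 / sin b * \<bar>V n\<bar>"
        using q(2)[of n] by (metis complex_mod_cnj)
    qed (use q in simp)
    have plus: "norm (S (\<lambda>n. p n * q n)) \<le> C (a + b) * tail_weight T"
      unfolding S_def C_def K_def
      using rotating_product_sum_le[OF V[rule_format] p q _ _ _ _ \<open>T \<le> M\<close>] assms
      by (simp add: cis_mult algebra_simps)
    have minus: "norm (S (\<lambda>n. p n * cnj (q n))) \<le> C (a - b) * tail_weight T" if "a \<noteq> b"
      unfolding S_def C_def K_def
      using rotating_product_sum_le[OF V[rule_format] p cnj_q _ _ _ _ \<open>T \<le> M\<close>] assms that
      by (simp add: cis_mult algebra_simps)
    have Re_S: "Re (S x) = (\<Sum>n=T..<M. Re (x n) / (real n + 1))" for x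
      unfolding S_def Re_sum by (simp only: Re_divide_of_real)
    have "(\<Sum>n=T..<M. interaction a b (w n) (z n) / (real n + 1))
        = (if a = b then 0 else Re (S (\<lambda>n. p n * cnj (q n)))) - Re (S (\<lambda>n. p n * q n))"
    proof (cases "a = b")
      case True
      have "interaction a b (w n) (z n) = - Re (p n * q n)" for n
      proof -
        have "norm (p n) = 1"
          using kicked_orbit_nonzero[OF w, of n] by (simp add: p_def norm_power norm_sgn)
        then have "(Re (p n))\<^sup>2 + (Im (p n))\<^sup>2 = 1" by (metis cmod_power2 one_power2)
        moreover have "q n = p n" using same True by (simp add: p_def q_def)
        ultimately show ?thesis
          unfolding interaction_def p_def[symmetric] q_def[symmetric]
          by (simp add: True power2_eq_square)
      qed
      then show ?thesis by (simp only: Re_S minus_divide_left[symmetric] sum_negf if_True)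
        (simp add: True)
    next
      case False
      then have "interaction a b (w n) (z n) = Re (p n * cnj (q n)) - Re (p n * q n)" for n
        unfolding interaction_def p_def[symmetric] q_def[symmetric] by simp
      with False show ?thesis
        by (simp add: Re_S sum_subtractf[symmetric] diff_divide_distrib[symmetric])
    qed
    then show ?thesis
      using plus minus abs_Re_le_cmod[of "S (\<lambda>n. p n * q n)"]
        abs_Re_le_cmod[of "S (\<lambda>n. p n * cnj (q n))"]
      by (auto simp: distrib_right)
  qed
  then show ?thesis unfolding interaction_bound_def by blast
qed

section \<open>Decay of a controlled orbit\<close>

lemma ln_le_sum_inverse:
  assumes "T \<le> M"
  shows "ln (real M + 1) - ln (real T + 1) \<le> (\<Sum>n=T..<M. 1 / (real n + 1))"
  using assms
proof (induction M rule: dec_induct)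
  case (step n)
  have "1 + 1 / (real n + 1) = (real (Suc n) + 1) / (real n + 1)" by (simp add: field_simps)
  then have "ln (real (Suc n) + 1) - ln (real n + 1) = ln (1 + 1 / (real n + 1))"
    by (simp add: ln_div)
  also have "\<dots> \<le> 1 / (real n + 1)" by (rule ln_add_one_self_le_self) simp
  finally show ?case using step by simp
qed simp

text \<open>
  Summing \<open>ln_norm_kick_le\<close> over time, the feedback of \<open>j\<close> itself yields \<open>- 2 \<Sum>n. 1 / (n + 1)\<close>,
  which is \<open>- 2 ln\<close> up to a constant; the interactions and the quadratic terms have bounded sums.
\<close>

lemma controlled_orbit_decay:
  fixes J :: "nat set" and k V :: "nat \<Rightarrow> real" and w :: "nat \<Rightarrow> nat \<Rightarrow> complex"
    and T :: "nat \<Rightarrow> nat" and c :: "nat \<Rightarrow> real"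
  defines "A n \<equiv> {i \<in> J. T i \<le> n}"
  assumes j: "j \<in> J" and inj: "inj_on k J" and sin_pos: "\<And>i. i \<in> J \<Longrightarrow> sin (k i) > 0"
    and orbit: "kicked_orbit (k j) V (w j)"
    and V: "\<And>n. V n = 4 / (real n + 1) * (\<Sum>i\<in>A n. sin (k i) * Im (double_phase (w i n)))"
    and fin: "\<And>n. finite (A n)"
    and V_small: "\<And>n. (V n)\<^sup>2 \<le> power_weight n"
    and c: "\<And>i M. i \<in> J \<Longrightarrow> max (T i) (T j) \<le> M \<Longrightarrow>
      \<bar>\<Sum>n=max (T i) (T j)..<M. interaction (k i) (k j) (w i n) (w j n) / (real n + 1)\<bar> \<le> c i"
    and c_summable: "summable (\<lambda>i. if i \<in> J then c i else 0)"
  shows "\<exists>C. \<forall>n\<ge>T j. (norm (w j n))\<^sup>2 \<le> C / (real n + 1)\<^sup>2"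
proof -
  define s where "s i = sin (k i)" for i
  define L where "L n = ln ((norm (w j n))\<^sup>2)" for n
  define I where "I i n = interaction (k i) (k j) (w i n) (w j n) / (real n + 1)" for i n
  have s: "s i > 0" "s i \<le> 1" if "i \<in> J" for i
    using sin_pos[OF that] by (simp_all add: s_def)
  have finite_A: "finite (A n)" and A_sub: "A n \<subseteq> J" for n
    using fin by (auto simp: A_def)
  have one_step: "L (Suc n) \<le> L n - 2 / (real n + 1) - 2 / s j * (\<Sum>i\<in>A n. s i * I i n) + (V n)\<^sup>2 / (s j)\<^sup>2"
    if "T j \<le> n" for n
  proof -
    define S where "S = (\<Sum>i\<in>A n. s i * Im (double_phase (w i n)))"
    have "(\<Sum>i\<in>A n. s i * I i n)
        = (\<Sum>i\<in>A n. 2 * Im (double_phase (w j n)) / (real n + 1) * (s i * Im (double_phase (w i n)))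
            - (if i = j then s j / (real n + 1) else 0))"
    proof (rule sum.cong)
      fix i assume "i \<in> A n"
      then have "k i = k j \<longleftrightarrow> i = j" using A_sub j inj by (auto dest: inj_onD)
      then show "s i * I i n
        = 2 * Im (double_phase (w j n)) / (real n + 1) * (s i * Im (double_phase (w i n)))
            - (if i = j then s j / (real n + 1) else 0)"
        by (simp add: I_def interaction_def divide_simps) (simp add: algebra_simps)
    qed simp
    also have "\<dots> = 2 * Im (double_phase (w j n)) / (real n + 1) * S - s j / (real n + 1)"
      using that j finite_A by (simp add: sum_subtractf S_def sum_distrib_left A_def)
    finally have "2 / s j * (\<Sum>i\<in>A n. s i * I i n)
        = V n / s j * Im (double_phase (w j n)) - 2 / (real n + 1)"
      using s[OF j] by (simp add: V s_def[symmetric] S_def[symmetric] divide_simps)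
    then show ?thesis
      using ln_norm_kick_le[OF kicked_orbit_nonzero[OF orbit, of n] sin_pos[OF j], where v = "V n"] orbit
      by (simp add: L_def kicked_orbit_def s_def power_divide)
  qed
  have telescoped: "L M \<le> L (T j) - 2 * (\<Sum>n=T j..<M. 1 / (real n + 1))
      - 2 / s j * (\<Sum>n=T j..<M. \<Sum>i\<in>A n. s i * I i n) + (\<Sum>n=T j..<M. (V n)\<^sup>2) / (s j)\<^sup>2"
    if "T j \<le> M" for M
    using that
  proof (induction M rule: dec_induct)
    case (step n)
    then show ?case
      using one_step[of n] by (simp add: algebra_simps add_divide_distrib)
  qed simp
  define c' where "c' i = (if i \<in> J then c i else 0)" for i
  have interactions: "\<bar>\<Sum>n=T j..<M. \<Sum>i\<in>A n. s i * I i n\<bar> \<le> suminf c'" if "T j \<le> M" for M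
  proof -
    have "(\<Sum>n=T j..<M. \<Sum>i\<in>A n. s i * I i n)
        = (\<Sum>n=T j..<M. \<Sum>i\<in>A M. if T i \<le> n then s i * I i n else 0)"
    proof (rule sum.cong)
      fix n assume "n \<in> {T j..<M}"
      then have "A n = A M \<inter> {i. T i \<le> n}" by (auto simp: A_def)
      then show "(\<Sum>i\<in>A n. s i * I i n) = (\<Sum>i\<in>A M. if T i \<le> n then s i * I i n else 0)"
        by (simp add: sum.inter_restrict[OF finite_A])
    qed simp
    also have "\<dots> = (\<Sum>i\<in>A M. \<Sum>n=T j..<M. if T i \<le> n then s i * I i n else 0)"
      by (rule sum.swap)
    \<comment> \<open>The feedback of \<open>i\<close> acts only from \<open>T i\<close> on, the estimate for \<open>j\<close> starts at \<open>T j\<close>.\<close>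
    also have "\<dots> = (\<Sum>i\<in>A M. s i * (\<Sum>n=max (T i) (T j)..<M. I i n))"
    proof (rule sum.cong)
      fix i
      have "{max (T i) (T j)..<M} = {T j..<M} \<inter> {n. T i \<le> n}" by auto
      then show "(\<Sum>n=T j..<M. if T i \<le> n then s i * I i n else 0)
          = s i * (\<Sum>n=max (T i) (T j)..<M. I i n)"
        using sum.inter_restrict[of "{T j..<M}" "\<lambda>n. s i * I i n" "{n. T i \<le> n}"]
        by (simp add: sum_distrib_left)
    qed simp
    also have "\<bar>\<dots>\<bar> \<le> (\<Sum>i\<in>A M. c' i)"
    proof (rule order_trans[OF sum_abs sum_mono])
      fix i assume i: "i \<in> A M"
      then have "i \<in> J" "max (T i) (T j) \<le> M" using that by (auto simp: A_def)
      then have "s i * \<bar>\<Sum>n=max (T i) (T j)..<M. I i n\<bar> \<le> 1 * c i"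
        using s[of i] c[of i M] by (intro mult_mono) (auto simp: I_def)
      then show "\<bar>s i * (\<Sum>n=max (T i) (T j)..<M. I i n)\<bar> \<le> c' i"
        using s[of i] \<open>i \<in> J\<close> by (simp add: abs_mult c'_def)
    qed
    also have "\<dots> \<le> suminf c'"
    proof (rule sum_le_suminf[OF _ finite_A])
      show "summable c'" using c_summable by (simp add: c'_def[abs_def])
      show "0 \<le> c' i" for i
        using c[of i "max (T i) (T j)"] by (simp add: c'_def)
    qed
    finally show ?thesis .
  qed
  define C where "C = L (T j) + 2 * ln (real (T j) + 1) + 2 / s j * suminf c' + suminf power_weight / (s j)\<^sup>2"
  have "(norm (w j M))\<^sup>2 \<le> exp C / (real M + 1)\<^sup>2" if "T j \<le> M" for M
  proof -
    have "(\<Sum>n=T j..<M. (V n)\<^sup>2) \<le> suminf power_weight"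
      using V_small summable_power_weight
      by (intro order_trans[OF sum_mono sum_le_suminf]) (auto simp: power_weight_nonneg)
    then have "(\<Sum>n=T j..<M. (V n)\<^sup>2) / (s j)\<^sup>2 \<le> suminf power_weight / (s j)\<^sup>2"
      by (simp add: divide_right_mono)
    moreover have "- (2 / s j * (\<Sum>n=T j..<M. \<Sum>i\<in>A n. s i * I i n)) \<le> 2 / s j * suminf c'"
      unfolding mult_minus_right[symmetric] using interactions[OF that] s[OF j]
      by (intro mult_left_mono) auto
    ultimately have "L M \<le> C - 2 * ln (real M + 1)"
      using telescoped[OF that] ln_le_sum_inverse[OF that] unfolding C_def by argo
    then have "exp (L M) \<le> exp (C - 2 * ln (real M + 1))" by simp
    also have "\<dots> = exp C / (real M + 1)\<^sup>2"
      by (simp add: exp_diff exp_double)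
    finally show ?thesis
      using kicked_orbit_nonzero[OF orbit] by (simp add: L_def)
  qed
  then show ?thesis by blast
qed

lemma square_summable_if_decay:
  assumes "\<forall>n\<ge>N. (norm (w n))\<^sup>2 \<le> C / (real n + 1)\<^sup>2"
  shows "square_summable (\<lambda>n. Im (w n) / s)"
proof -
  have "summable (\<lambda>n. C / s\<^sup>2 * (1 / (real n + 1)\<^sup>2))"
  proof (rule summable_mult)
    have "summable (\<lambda>n. inverse ((real (Suc n))\<^sup>2))"
      using inverse_power_summable[of 2, where ?'a = real] by (subst summable_Suc_iff) simp
    then show "summable (\<lambda>n. 1 / (real n + 1)\<^sup>2)" by (simp add: divide_inverse add.commute)
  qed
  moreover have "norm ((Im (w n) / s)\<^sup>2) \<le> C / s\<^sup>2 * (1 / (real n + 1)\<^sup>2)" if "n \<ge> N" for n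
  proof -
    have "(Im (w n))\<^sup>2 \<le> (norm (w n))\<^sup>2" by (simp add: cmod_power2)
    also have "\<dots> \<le> C / (real n + 1)\<^sup>2" using assms that by blast
    finally have "(Im (w n))\<^sup>2 \<le> C / (real n + 1)\<^sup>2" .
    then have "(Im (w n))\<^sup>2 / s\<^sup>2 \<le> C / (real n + 1)\<^sup>2 / s\<^sup>2"
      by (rule divide_right_mono) simp
    then show ?thesis by (simp add: power_divide mult.commute)
  qed
  ultimately have "summable (\<lambda>n. (Im (w n) / s)\<^sup>2)"
    by (rule summable_comparison_test')
  then have "(\<lambda>n. (Im (w n) / s)\<^sup>2) summable_on UNIV"
    by (subst summable_on_UNIV_nonneg_real_iff) auto
  then show ?thesis
    unfolding square_summable_def by (rule summable_on_subset) simp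
qed

section \<open>The feedback potential\<close>

text \<open>
  The potential at time \<open>n\<close> is a function of the state of all orbits at time \<open>n\<close>, so both are
  obtained by recursion on the state.
\<close>

lemma feedback_system_exists:
  fixes F :: "nat \<Rightarrow> (nat \<Rightarrow> complex) \<Rightarrow> real"
  shows "\<exists>V w. (\<forall>i. w i 0 = x i) \<and> (\<forall>i n. w i (Suc n) = kick (k i) (V n) (w i n)) \<and>
    (\<forall>n. V n = F n (\<lambda>i. w i n))"
proof -
  define W where "W = rec_nat x (\<lambda>n y i. kick (k i) (F n y) (y i))"
  show ?thesis
    by (rule exI[of _ "\<lambda>n. F n (W n)"], rule exI[of _ "\<lambda>i n. W n i"]) (simp add: W_def)
qed

text \<open>
  Each requirement on \<open>T i\<close> concerns finitely many conditions that hold for all late times.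
  Demanding \<open>T i \<ge> 1\<close> keeps \<open>V 0 = 0\<close>, so that the first step does not spoil the boundary values.
\<close>

lemma activation_times_exist:
  fixes H :: "nat \<Rightarrow> real" and D :: "nat \<Rightarrow> nat \<Rightarrow> real"
  assumes "filterlim H at_top sequentially"
  shows "\<exists>T. \<forall>i. T i \<ge> (1::nat) \<and>
    (\<forall>n\<ge>T i. 4 * (real i + 1) \<le> H n \<and> (\<forall>j\<le>i. D i j * tail_weight n \<le> (1 / 2) ^ i))"
proof -
  have "\<exists>t\<ge>(1::nat). \<forall>n\<ge>t. 4 * (real i + 1) \<le> H n \<and> (\<forall>j\<le>i. D i j * tail_weight n \<le> (1 / 2) ^ i)" for i
  proof -
    have "\<forall>\<^sub>F n in sequentially. 4 * (real i + 1) \<le> H n"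
      using assms by (simp add: filterlim_at_top)
    moreover have "\<forall>\<^sub>F n in sequentially. \<forall>j\<in>{..i}. D i j * tail_weight n < (1 / 2) ^ i"
    proof (intro eventually_ball_finite ballI)
      fix j
      have "(\<lambda>n. D i j * tail_weight n) \<longlonglongrightarrow> D i j * 0"
        by (intro tendsto_intros tail_weight_tendsto)
      then show "\<forall>\<^sub>F n in sequentially. D i j * tail_weight n < (1 / 2) ^ i"
        by (rule order_tendstoD) simp
    qed simp
    ultimately have "\<forall>\<^sub>F n in sequentially. 4 * (real i + 1) \<le> H n \<and>
        (\<forall>j\<le>i. D i j * tail_weight n \<le> (1 / 2) ^ i)"
      by eventually_elim (auto intro: less_imp_le)
    then obtain N where "\<forall>n\<ge>N. 4 * (real i + 1) \<le> H n \<and> (\<forall>j\<le>i. D i j * tail_weight n \<le> (1 / 2) ^ i)"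
      unfolding eventually_sequentially by blast
    then show ?thesis by (intro exI[of _ "max 1 N"]) simp
  qed
  then show ?thesis by metis
qed

text \<open>
  The \<open>i\<close>-th energy waits until the budget reaches \<open>4 (i + 1)\<close>, so the number of active energies
  never exceeds a quarter of the budget.
\<close>

lemma card_active_le:
  fixes H :: real
  assumes "\<And>i. i \<in> A \<Longrightarrow> 4 * (real i + 1) \<le> H" "H \<ge> 0"
  shows "finite A" "4 * real (card A) \<le> H"
proof -
  have A: "A \<subseteq> {..<nat \<lfloor>H / 4\<rfloor>}"
  proof
    fix i assume "i \<in> A"
    then have "real (i + 1) \<le> H / 4" using assms(1)[of i] by simp
    then show "i \<in> {..<nat \<lfloor>H / 4\<rfloor>}" by (simp add: le_nat_floor Suc_le_eq[symmetric])
  qed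
  then show "finite A" by (rule finite_subset) simp
  have "card A \<le> nat \<lfloor>H / 4\<rfloor>" using card_mono[OF _ A] by simp
  then have "real (card A) \<le> H / 4" using \<open>H \<ge> 0\<close> by linarith
  then show "4 * real (card A) \<le> H" by simp
qed

lemma feedback_abs_le:
  assumes "finite A" "4 * real (card A) \<le> H"
  shows "\<bar>4 / (real n + 1) * (\<Sum>i\<in>A. sin (k i) * Im (double_phase (w i)))\<bar> \<le> H / (real n + 1)"
proof -
  have "\<bar>\<Sum>i\<in>A. sin (k i) * Im (double_phase (w i))\<bar> \<le> (\<Sum>i\<in>A. 1)"
  proof (rule order_trans[OF sum_abs sum_mono])
    fix i
    have "\<bar>Im (double_phase (w i))\<bar> \<le> 1"
      using abs_Im_le_cmod norm_double_phase_le_1 by (rule order_trans)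
    then show "\<bar>sin (k i) * Im (double_phase (w i))\<bar> \<le> 1"
      unfolding abs_mult by (intro mult_le_one) auto
  qed
  then have "4 * \<bar>\<Sum>i\<in>A. sin (k i) * Im (double_phase (w i))\<bar> \<le> H"
    using assms(2) by simp
  then show ?thesis by (simp add: abs_mult divide_right_mono)
qed

lemma power_weight_bounds:
  assumes "\<bar>v\<bar> \<le> sqrt (sqrt (1 + real n)) / (real n + 1)"
  shows "v\<^sup>2 \<le> power_weight n" "\<bar>v\<bar> / (real n + 1) \<le> power_weight n"
proof -
  have "sqrt (sqrt (1 + real n)) = (real n + 1) powr (1 / 4)"
    by (simp add: powr_half_sqrt[symmetric] powr_powr add.commute)
  then have v: "\<bar>v\<bar> \<le> (real n + 1) powr (- 3 / 4)"
    using assms powr_diff[of "real n + 1" "1 / 4" 1] by simp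
  have "v\<^sup>2 \<le> ((real n + 1) powr (- 3 / 4))\<^sup>2"
    using power_mono[OF v, of 2] by simp
  then show "v\<^sup>2 \<le> power_weight n"
    by (simp add: power_weight_def powr_power)
  have "\<bar>v\<bar> / (real n + 1) \<le> (real n + 1) powr (- 3 / 4) / (real n + 1)"
    using v by (simp add: divide_right_mono)
  also have "\<dots> = (real n + 1) powr (- 7 / 4)"
    using powr_diff[of "real n + 1" "- 3 / 4" 1] by simp
  also have "\<dots> \<le> power_weight n"
    unfolding power_weight_def by (intro powr_mono) auto
  finally show "\<bar>v\<bar> / (real n + 1) \<le> power_weight n" .
qed

theorem theorem2p13:
  fixes J :: "nat set" and E \<theta> :: "nat \<Rightarrow> real" and B :: "real set" and h :: "nat \<Rightarrow> real"
  assumes "B = E ` J"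
    and "inj_on E J"
    and "B \<subseteq> {-2<..<2}"
    and "0 \<notin> B + B"
    and "\<forall>j\<in>J. \<theta> j \<in> {0..pi}"
    and "\<forall>n\<ge>1. h n > 0"
    and "filterlim h at_top sequentially"
  shows "\<exists>V :: nat \<Rightarrow> real.
           (\<forall>n\<ge>1. \<bar>V n\<bar> \<le> h n / (1 + real n)) \<and>
           (\<forall>j\<in>J. \<exists>u :: nat \<Rightarrow> real.
              schroedinger_solution V (E j) u \<and> (\<exists>n\<ge>1. u n \<noteq> 0) \<and>
              square_summable u \<and> boundary_condition (\<theta> j) u)"
proof -
  define k where "k i = arccos (E i / 2)" for i
  have k: "0 < k i" "k i < pi" "2 * cos (k i) = E i" "sin (k i) > 0" if "i \<in> J" for i
  proof -
    have "E i \<in> {-2<..<2}" using that assms(1,3) by auto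
    then show "0 < k i" "k i < pi" "2 * cos (k i) = E i"
      unfolding k_def using arccos_lt_bounded[of "E i / 2"] by (auto simp: cos_arccos)
    then show "sin (k i) > 0" by (intro sin_gt_zero)
  qed
  have inj_k: "inj_on k J"
    using k(3) assms(2) by (metis inj_on_def)
  have "\<exists>d. interaction_bound (k i) (k j) d" if "i \<in> J" "j \<in> J" for i j
  proof (rule interaction_bound_exists)
    have "E i + E j \<noteq> 0"
      using assms(1,4) that set_plus_intro[of "E i" B "E j" B] by auto
    then show "cis (2 * (k i + k j)) \<noteq> 1"
      using k[OF that(1)] k[OF that(2)] by (intro nonresonant_sum) auto
    show "k i \<noteq> k j \<longrightarrow> cis (2 * (k i - k j)) \<noteq> 1"
      using k[OF that(1)] k[OF that(2)] by (intro impI nonresonant_diff) auto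
  qed (use k that in auto)
  then obtain D where D: "interaction_bound (k i) (k j) (D i j)" if "i \<in> J" "j \<in> J" for i j
    by metis
  \<comment> \<open>The root makes the potential small enough for its squares to be summable.\<close>
  define H where "H n = min (h n) (sqrt (sqrt (1 + real n)))" for n
  have "filterlim H at_top sequentially"
  proof -
    have "filterlim (\<lambda>n. sqrt (sqrt (1 + real n))) at_top sequentially"
      by (intro filterlim_compose[OF sqrt_at_top] filterlim_tendsto_add_at_top[OF tendsto_const]
          filterlim_real_sequentially)
    then show ?thesis
      using assms(7) unfolding H_def filterlim_at_top min.bounded_iff by (simp add: eventually_conj)
  qed
  then obtain T where T: "T i \<ge> (1::nat)"
    "n \<ge> T i \<Longrightarrow> 4 * (real i + 1) \<le> H n"
    "n \<ge> T i \<Longrightarrow> j \<le> i \<Longrightarrow> D i j * tail_weight n \<le> (1 / 2) ^ i" for i j n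
    using activation_times_exist[of H D] by metis
  define A where "A n = {i \<in> J. T i \<le> n}" for n
  \<comment> \<open>With \<open>V 0 = 0\<close> this initial state gives \<open>u 0 = cos \<theta>\<close> and \<open>u 1 = sin \<theta>\<close>.\<close>
  obtain V w where w_0: "\<And>i. w i 0 = of_real (sin (\<theta> i)) - cis (- k i) * of_real (cos (\<theta> i))"
    and w_Suc: "\<And>i n. w i (Suc n) = kick (k i) (V n) (w i n)"
    and V: "\<And>n. V n = 4 / (real n + 1) * (\<Sum>i\<in>A n. sin (k i) * Im (double_phase (w i n)))"
    using feedback_system_exists[of "\<lambda>i. of_real (sin (\<theta> i)) - cis (- k i) * of_real (cos (\<theta> i))" k
      "\<lambda>n x. 4 / (real n + 1) * (\<Sum>i\<in>A n. sin (k i) * Im (double_phase (x i)))"]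
    by blast
  have A_0: "A 0 = {}" using T(1) by (auto simp: A_def Suc_le_eq)
  have A: "finite (A n)" "4 * real (card (A n)) \<le> H n" if "n \<ge> 1" for n
    using card_active_le[of "A n" "H n"] T(2) that assms(6) by (auto simp: A_def H_def)
  have V_le: "\<bar>V n\<bar> \<le> H n / (real n + 1)" if "n \<ge> 1" for n
    unfolding V by (rule feedback_abs_le[OF A[OF that]])
  have "\<bar>V n\<bar> \<le> sqrt (sqrt (1 + real n)) / (real n + 1)" for n
  proof (cases "n = 0")
    case False
    then show ?thesis
      by (intro order_trans[OF V_le divide_right_mono]) (auto simp: H_def)
  qed (simp add: V A_0)
  note V_small = power_weight_bounds[OF this]
  have orbit: "kicked_orbit (k j) V (w j)" if "j \<in> J" for j
  proof -
    have "w j 0 \<noteq> 0"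
    proof
      assume "w j 0 = 0"
      then have "sin (k j) * cos (\<theta> j) = 0" "sin (\<theta> j) - cos (k j) * cos (\<theta> j) = 0"
        by (simp_all add: w_0 complex_eq_iff)
      then have "cos (\<theta> j) = 0" "sin (\<theta> j) = 0" using k(4)[OF that] by auto
      then show False using sin_cos_squared_add[of "\<theta> j"] by simp
    qed
    then show ?thesis by (simp add: kicked_orbit_def w_Suc)
  qed
  have decay: "\<exists>C. \<forall>n\<ge>T j. (norm (w j n))\<^sup>2 \<le> C / (real n + 1)\<^sup>2" if j: "j \<in> J" for j
  proof (rule controlled_orbit_decay[where k = k and V = V and w = w and J = J])
    define c where "c i = D i j * tail_weight (max (T i) (T j))" for i
    show c: "\<bar>\<Sum>n=max (T i) (T j)..<M. interaction (k i) (k j) (w i n) (w j n) / (real n + 1)\<bar> \<le> c i"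
      if "i \<in> J" "max (T i) (T j) \<le> M" for i M
      using D[OF that(1) j] V_small(2) orbit[OF that(1)] orbit[OF j] inj_onD[OF inj_k _ that(1) j] that(2)
      unfolding interaction_bound_def c_def by blast
    show "summable (\<lambda>i. if i \<in> J then c i else 0)"
    proof (rule summable_comparison_test')
      show "summable (\<lambda>i. (1 / 2 :: real) ^ i)" by simp
      show "norm (if i \<in> J then c i else 0) \<le> (1 / 2) ^ i" if "i \<ge> j" for i
        using c[of i "max (T i) (T j)"] T(3)[of i "max (T i) (T j)" j] that by (simp add: c_def)
    qed
    show "finite {i \<in> J. T i \<le> n}" for n
      unfolding A_def[symmetric] using A(1)[of n] A_0 by (cases "n = 0") auto
    show "V n = 4 / (real n + 1) * (\<Sum>i\<in>{i \<in> J. T i \<le> n}. sin (k i) * Im (double_phase (w i n)))" for n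
      using V[of n] unfolding A_def .
  qed (fact j inj_k k(4) orbit[OF j] V_small(1))+
  show ?thesis
  proof (rule exI[of _ V], intro conjI allI impI ballI)
    show "\<bar>V n\<bar> \<le> h n / (1 + real n)" if "n \<ge> 1" for n
      using V_le[OF that] by (rule order_trans) (auto simp: H_def add.commute intro!: divide_right_mono)
  next
    fix j assume j: "j \<in> J"
    define u where "u n = Im (w j n) / sin (k j)" for n
    have "schroedinger_solution V (E j) u"
      using kicked_orbit_solution[OF orbit[OF j]] k[OF j] by (simp add: u_def[abs_def])
    moreover have u_0_1: "u 0 = cos (\<theta> j)" "u 1 = sin (\<theta> j)"
    proof -
      have "V 0 = 0" by (simp add: V A_0)
      then have "w j 1 = cis (k j) * of_real (sin (\<theta> j)) - of_real (cos (\<theta> j))"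
        by (simp add: w_Suc w_0 kick_def right_diff_distrib mult.assoc[symmetric] cis_mult)
      then show "u 0 = cos (\<theta> j)" "u 1 = sin (\<theta> j)"
        using k(4)[OF j] by (simp_all add: u_def w_0)
    qed
    moreover have "\<exists>n\<ge>1. u n \<noteq> 0"
    proof (rule ccontr)
      assume "\<not> ?thesis"
      then have "u 1 = 0" "u 2 = 0" by auto
      then have "u 0 = 0"
        using \<open>schroedinger_solution V (E j) u\<close>
        unfolding schroedinger_solution_def by (auto dest: spec[of _ 1] simp: numeral_2_eq_2)
      with u_0_1 \<open>u 1 = 0\<close> show False using sin_cos_squared_add[of "\<theta> j"] by simp
    qed
    moreover have "square_summable u"
      using decay[OF j] square_summable_if_decay unfolding u_def[abs_def] by blast
    ultimately show "\<exists>u. schroedinger_solution V (E j) u \<and> (\<exists>n\<ge>1. u n \<noteq> 0) \<and>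
        square_summable u \<and> boundary_condition (\<theta> j) u"
      by (intro exI[of _ u]) (simp add: boundary_condition_def mult.commute)
  qed
qed

end
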